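(* Let $0<\xi<1$, $\alpha>0$, $\bar w(x)=|x-\xi|^\alpha$. For any $f\in C_{\bar w}$ there is a constant $C>0$, independent of $n$ and $x$, such that for all admissible $n$ $$\|\bar w\,\bar B_n''(f)\|\le C n^2\|\bar w f\|,$$ where $\bar B_n''(f)$ is the second derivative of the polynomial $\bar B_n(f,\cdot)$ and $\|\cdot\|$ is the supremum norm on $[0,1]$.
   Context: Fix $0<\xi<1$, $\alpha>0$, and $\bar w(x)=|x-\xi|^\alpha$. $C_{\bar w}$ is the set of all $f\in C([0,1]\setminus\{\xi\})$ with $\lim_{x\to\xi}(\bar w f)(x)=0$; $\|\bar w f\|=\sup_{0\le x\le 1}|(\bar w f)(x)|$, with $(\bar w f)(\xi):=0$. For $n\in\mathbb N$, $p_{n,k}(x)=\binom nk x^k(1-x)^{n-k}$ and $B_n(g,x)=\sum_{k=0}^n g(k/n)p_{n,k}(x)$ is the Bernstein operator. Let $\psi(x)=10x^3-15x^4+6x^5$ for $0<x<1$, $\psi(x)=0$ for $x\le 0$, $\psi(x)=1$ for $x\ge 1$. With $[\cdot]$ the integer part, put $$x_1=\tfrac{[n\xi-2\sqrt n]}{n},\quad x_2=\tfrac{[n\xi-\sqrt n]}{n},\quad x_3=\tfrac{[n\xi+\sqrt n]}{n},\quad x_4=\tfrac{[n\xi+2\sqrt n]}{n},$$ $\bar\psi_1(x)=\psi\big(\tfrac{x-x_1}{x_2-x_1}\big)$, $\bar\psi_2(x)=\psi\big(\tfrac{x-x_3}{x_4-x_3}\big)$. A positive integer $n$ is called admissible if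 $x_1\ge 0$ and $x_4\le 1$ (true for all large $n$). Let $$P(x)=P(f,x)=\tfrac{x-x_4}{x_1-x_4}f(x_1)+\tfrac{x_1-x}{x_1-x_4}f(x_4),$$ $$\bar F_n(f,x)=f(x)\big(1-\bar\psi_1(x)+\bar\psi_2(x)\big)+\bar\psi_1(x)\big(1-\bar\psi_2(x)\big)P(x),$$ so that $\bar F_n(f,\cdot)=f$ on $[0,x_1]\cup[x_4,1]$ and $\bar F_n(f,\cdot)=P$ on $[x_2,x_3]$ (where the value of $f$ is not used). Define $\bar B_n(f,x)=B_n(\bar F_n(f),x)$. *)

theory Defs
  imports "HOL-Analysis.Analysis"
begin

text \<open>Functions on \<open>[0,1]\<close> and on \<open>[0,1]\<close> without \<open>\<xi>\<close> are total functions on the reals.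
  The value of \<open>f\<close> at \<open>\<xi>\<close> is always multiplied by zero when \<open>n \<ge> 1\<close>.\<close>

text \<open>As \<open>0 powr \<alpha> = 0\<close>, the product \<open>wbar \<xi> \<alpha> x * f x\<close> vanishes at \<open>x = \<xi>\<close>, whatever
  \<open>f \<xi>\<close> is.\<close>
definition wbar :: "real \<Rightarrow> real \<Rightarrow> real \<Rightarrow> real" where
  "wbar \<xi> \<alpha> x = \<bar>x - \<xi>\<bar> powr \<alpha>"

definition C_wbar :: "real \<Rightarrow> real \<Rightarrow> (real \<Rightarrow> real) set" where
  "C_wbar \<xi> \<alpha> = {f. continuous_on ({0..1} - {\<xi>}) f \<and>
     ((\<lambda>x. wbar \<xi> \<alpha> x * f x) \<longlongrightarrow> 0) (at \<xi> within {0..1})}"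

definition sup_norm :: "(real \<Rightarrow> real) \<Rightarrow> real" where
  "sup_norm g = (SUP x\<in>{0..1}. \<bar>g x\<bar>)"

definition bernstein_op :: "nat \<Rightarrow> (real \<Rightarrow> real) \<Rightarrow> real \<Rightarrow> real" where
  "bernstein_op n g x = (\<Sum>k\<le>n. g (real k / real n) * Bernstein n k x)"

definition \<psi> :: "real \<Rightarrow> real" where
  "\<psi> x = (if x \<le> 0 then 0 else if x \<ge> 1 then 1 else 10 * x ^ 3 - 15 * x ^ 4 + 6 * x ^ 5)"

definition x1 :: "real \<Rightarrow> nat \<Rightarrow> real" where
  "x1 \<xi> n = real_of_int \<lfloor>real n * \<xi> - 2 * sqrt (real n)\<rfloor> / real n"

definition x2 :: "real \<Rightarrow> nat \<Rightarrow> real" where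
  "x2 \<xi> n = real_of_int \<lfloor>real n * \<xi> - sqrt (real n)\<rfloor> / real n"

definition x3 :: "real \<Rightarrow> nat \<Rightarrow> real" where
  "x3 \<xi> n = real_of_int \<lfloor>real n * \<xi> + sqrt (real n)\<rfloor> / real n"

definition x4 :: "real \<Rightarrow> nat \<Rightarrow> real" where
  "x4 \<xi> n = real_of_int \<lfloor>real n * \<xi> + 2 * sqrt (real n)\<rfloor> / real n"

definition admissible :: "real \<Rightarrow> nat \<Rightarrow> bool" where
  "admissible \<xi> n \<longleftrightarrow> n > 0 \<and> x1 \<xi> n \<ge> 0 \<and> x4 \<xi> n \<le> 1"

definition psi1 :: "real \<Rightarrow> nat \<Rightarrow> real \<Rightarrow> real" where
  "psi1 \<xi> n x = \<psi> ((x - x1 \<xi> n) / (x2 \<xi> n - x1 \<xi> n))"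

definition psi2 :: "real \<Rightarrow> nat \<Rightarrow> real \<Rightarrow> real" where
  "psi2 \<xi> n x = \<psi> ((x - x3 \<xi> n) / (x4 \<xi> n - x3 \<xi> n))"

definition P_lin :: "real \<Rightarrow> nat \<Rightarrow> (real \<Rightarrow> real) \<Rightarrow> real \<Rightarrow> real" where
  "P_lin \<xi> n f x =
     (x - x4 \<xi> n) / (x1 \<xi> n - x4 \<xi> n) * f (x1 \<xi> n) +
     (x1 \<xi> n - x) / (x1 \<xi> n - x4 \<xi> n) * f (x4 \<xi> n)"

definition Fbar :: "real \<Rightarrow> nat \<Rightarrow> (real \<Rightarrow> real) \<Rightarrow> real \<Rightarrow> real" where
  "Fbar \<xi> n f x =
     f x * (1 - psi1 \<xi> n x + psi2 \<xi> n x) +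
     psi1 \<xi> n x * (1 - psi2 \<xi> n x) * P_lin \<xi> n f x"

definition Bbar :: "real \<Rightarrow> nat \<Rightarrow> (real \<Rightarrow> real) \<Rightarrow> real \<Rightarrow> real" where
  "Bbar \<xi> n f = bernstein_op n (Fbar \<xi> n f)"

end

theory Submission
  imports Defs
begin

text \<open>The second derivative of a Bernstein polynomial of degree \<open>n\<close> is \<open>n (n - 1)\<close> times the
  Bernstein polynomial of degree \<open>n - 2\<close> of the second differences of its coefficients. Write
  \<open>M\<close> for the norm of \<open>wbar f\<close>. The truncation removes the singularity at scale \<open>1 / sqrt n\<close>:
  \<open>|Fbar(t)|\<close> is at most a constant times \<open>M (|t - \<xi>| + 1 / sqrt n) powr (-\<alpha>)\<close>, and moving \<open>t\<close> by
  at most \<open>2 / n\<close> changes this majorant only by a constant factor. Since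
  \<open>|x - \<xi>| \<le> (|k/n - \<xi>| + 1 / sqrt n) (1 + sqrt n |x - k/n|)\<close>, the weight \<open>|x - \<xi>| powr \<alpha>\<close> is
  absorbed at the price of a factor \<open>(1 + sqrt n |x - k/n|) powr \<alpha>\<close>, whose binomial average is
  bounded through exponential moments.\<close>

section \<open>Bernstein sums of coefficient sequences and their derivatives\<close>

text \<open>Indexed by coefficients rather than by a sampled function, so that shifts and
  differences of coefficients stay within the same form.\<close>

definition bernstein_sum :: "nat \<Rightarrow> (nat \<Rightarrow> real) \<Rightarrow> real \<Rightarrow> real" where
  "bernstein_sum n a x = (\<Sum>k\<le>n. a k * Bernstein n k x)"

text \<open>This is Pascal's rule for the Bernstein basis, or one step of de Casteljau's
  algorithm.\<close>

lemma bernstein_sum_Suc: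
  "bernstein_sum (Suc n) a x =
     (1 - x) * bernstein_sum n a x + x * bernstein_sum n (\<lambda>k. a (Suc k)) x"
proof -
  have B: "Bernstein (Suc n) (Suc k) x = (1 - x) * Bernstein n (Suc k) x + x * Bernstein n k x"
    if "k \<le> n" for k
  proof (cases "k = n")
    case True
    then show ?thesis by (simp add: Bernstein_def)
  next
    \<comment> \<open>Below the top index one factor \<open>1 - x\<close> can be split off; at
      \<open>k = n\<close> the term \<open>Bernstein n (Suc k) x\<close> is zero instead.\<close>
    case False
    then have "n - k = Suc (n - Suc k)" using that by simp
    then show ?thesis by (simp add: Bernstein_def algebra_simps)
  qed
  have B0: "Bernstein n 0 x = (1 - x) ^ n"
    by (simp add: Bernstein_def)
  have "bernstein_sum (Suc n) a x = a 0 * (1 - x) ^ Suc n +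
      (\<Sum>k\<le>n. a (Suc k) * Bernstein (Suc n) (Suc k) x)"
    unfolding bernstein_sum_def by (subst sum.atMost_Suc_shift) (simp add: Bernstein_def)
  also have "\<dots> = a 0 * (1 - x) ^ Suc n +
      (\<Sum>k\<le>n. (1 - x) * (a (Suc k) * Bernstein n (Suc k) x) + x * (a (Suc k) * Bernstein n k x))"
    by (intro arg_cong2[of _ _ _ _ "(+)"] sum.cong refl) (simp add: B algebra_simps)
  also have "\<dots> = (1 - x) * (a 0 * Bernstein n 0 x + (\<Sum>k\<le>n. a (Suc k) * Bernstein n (Suc k) x)) +
      x * bernstein_sum n (\<lambda>k. a (Suc k)) x"
    unfolding sum.distrib sum_distrib_left[symmetric] bernstein_sum_def B0 by (simp add: distrib_left)
  also have "a 0 * Bernstein n 0 x + (\<Sum>k\<le>n. a (Suc k) * Bernstein n (Suc k) x) =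
      (\<Sum>k\<le>Suc n. a k * Bernstein n k x)"
    by (simp only: sum.atMost_Suc_shift)
  \<comment> \<open>The summand at the extra index \<open>Suc n\<close> vanishes.\<close>
  also have "\<dots> = bernstein_sum n a x"
    by (simp add: bernstein_sum_def Bernstein_def)
  finally show ?thesis .
qed

lemma bernstein_sum_diff:
  "bernstein_sum n (\<lambda>k. a k - b k) x = bernstein_sum n a x - bernstein_sum n b x"
  by (simp add: bernstein_sum_def algebra_simps sum_subtractf)

text \<open>Induction on the degree: differentiating the recursion gives one copy of
  \<open>bernstein_sum n d\<close> from the factors \<open>1 - x\<close> and \<open>x\<close>, and
  \<open>n\<close> further copies from the induction hypothesis.\<close>

lemma DERIV_bernstein_sum:
  "(bernstein_sum n a has_real_derivative
     real n * bernstein_sum (n - 1) (\<lambda>k. a (Suc k) - a k) x) (at x)"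
proof (induction n arbitrary: a)
  case 0
  have "bernstein_sum 0 a = (\<lambda>x. a 0)"
    by (simp add: fun_eq_iff bernstein_sum_def Bernstein_def)
  then show ?case by simp
next
  case (Suc n)
  define d where "d = (\<lambda>k. a (Suc k) - a k)"
  have eq: "bernstein_sum (Suc n) a = (\<lambda>x. (1 - x) * bernstein_sum n a x +
      x * bernstein_sum n (\<lambda>k. a (Suc k)) x)"
    by (simp add: fun_eq_iff bernstein_sum_Suc)
  have "((\<lambda>x. (1 - x) * bernstein_sum n a x + x * bernstein_sum n (\<lambda>k. a (Suc k)) x)
      has_real_derivative
      bernstein_sum n d x + real n * ((1 - x) * bernstein_sum (n - 1) d x +
        x * bernstein_sum (n - 1) (\<lambda>k. d (Suc k)) x)) (at x)"
    by (rule derivative_eq_intros Suc.IH refl)+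
       (simp add: d_def bernstein_sum_diff algebra_simps)
  \<comment> \<open>For \<open>n > 0\<close> this is the recursion read backwards; for
    \<open>n = 0\<close> both sides vanish.\<close>
  moreover have "real n * ((1 - x) * bernstein_sum (n - 1) d x +
      x * bernstein_sum (n - 1) (\<lambda>k. d (Suc k)) x) = real n * bernstein_sum n d x"
    by (cases n) (auto simp: bernstein_sum_Suc)
  ultimately show ?case
    unfolding eq d_def[symmetric] by (simp add: algebra_simps)
qed

text \<open>Truncated subtraction does no harm: for \<open>n\<close> at most 1 the prefactor is
  zero.\<close>

lemma deriv2_bernstein_sum:
  "(deriv ^^ 2) (bernstein_sum n a) x = real n * real (n - 1) *
     bernstein_sum (n - 2) (\<lambda>k. a (k + 2) - 2 * a (k + 1) + a k) x"
proof -
  have D: "deriv (bernstein_sum m b) = (\<lambda>x. real m *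
      bernstein_sum (m - 1) (\<lambda>k. b (Suc k) - b k) x)" for m b
    using DERIV_bernstein_sum by (intro ext DERIV_imp_deriv)
  have "(deriv ^^ 2) (bernstein_sum n a) x =
      deriv (\<lambda>x. real n * bernstein_sum (n - 1) (\<lambda>k. a (Suc k) - a k) x) x"
    by (simp add: numeral_2_eq_2 D)
  also have "\<dots> = real n * deriv (bernstein_sum (n - 1) (\<lambda>k. a (Suc k) - a k)) x"
    using DERIV_bernstein_sum by (intro deriv_cmult) (auto simp: field_differentiable_def)
  finally show ?thesis
    by (simp add: D numeral_2_eq_2 algebra_simps)
qed

lemma bernstein_sum_abs_le:
  assumes "0 \<le> x" "x \<le> 1" "\<And>k. k \<le> n \<Longrightarrow> \<bar>a k\<bar> \<le> b k"
  shows "\<bar>bernstein_sum n a x\<bar> \<le> bernstein_sum n b x"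
  unfolding bernstein_sum_def
  using assms
  by (intro order_trans[OF sum_abs] sum_mono)
     (auto simp: abs_mult Bernstein_nonneg intro!: mult_right_mono)

section \<open>Exponential moments of the binomial distribution\<close>

text \<open>The moment generating function of a centred binomial variable factors over the
  independent trials; here the factorisation is the binomial theorem.\<close>

lemma bernstein_sum_exp:
  "bernstein_sum m (\<lambda>k. exp (s * (real k - real m * x))) x =
     ((1 - x) * exp (- s * x) + x * exp (s * (1 - x))) ^ m"
proof -
  have "bernstein_sum m (\<lambda>k. exp (s * (real k - real m * x))) x =
      (\<Sum>k\<le>m. real (m choose k) * (x * exp (s * (1 - x))) ^ k * ((1 - x) * exp (- s * x)) ^ (m - k))"
    unfolding bernstein_sum_def Bernstein_def
  proof (intro sum.cong refl)
    fix k assume "k \<in> {..m}"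
    \<comment> \<open>Writes \<open>k - m * x\<close> as \<open>k * (1 - x) - (m - k) * x\<close>,
      which separates successes from failures.\<close>
    then have "exp (s * (real k - real m * x)) = exp (s * (1 - x)) ^ k * exp (- s * x) ^ (m - k)"
      by (simp add: exp_of_nat_mult[symmetric] exp_add[symmetric] of_nat_diff algebra_simps)
    then show "exp (s * (real k - real m * x)) * (real (m choose k) * x ^ k * (1 - x) ^ (m - k)) =
      real (m choose k) * (x * exp (s * (1 - x))) ^ k * ((1 - x) * exp (- s * x)) ^ (m - k)"
      by (simp add: power_mult_distrib)
  qed
  also have "\<dots> = ((1 - x) * exp (- s * x) + x * exp (s * (1 - x))) ^ m"
    unfolding add.commute[of "(1 - x) * exp (- s * x)"] binomial_ring ..
  finally show ?thesis .
qed

lemma exp_le_quadratic: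
  fixes y :: real
  assumes "\<bar>y\<bar> \<le> 1"
  shows "exp y \<le> 1 + y + y\<^sup>2"
proof (cases "0 \<le> y")
  case True
  then show ?thesis using assms exp_bound by simp
next
  case False
  define z where "z = - y"
  have z: "0 < z" "z \<le> 1" using False assms by (auto simp: z_def)
  \<comment> \<open>The product equals \<open>1 + z ^ 3\<close>.\<close>
  have "1 \<le> (1 + z) * (1 - z + z\<^sup>2)"
    using z by (simp add: algebra_simps power2_eq_square)
  also have "\<dots> \<le> exp z * (1 - z + z\<^sup>2)"
    using z exp_ge_add_one_self[of z] by (intro mult_right_mono) auto
  finally have "exp (- z) \<le> 1 - z + z\<^sup>2"
    by (simp add: exp_minus field_simps)
  then show ?thesis by (simp add: z_def)
qed

text \<open>The centred binomial variable with \<open>m\<close> trials has standard deviation at most \<open>sqrt m\<close>, so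
  \<open>1 / sqrt m\<close> is the scale on which its exponential moments stay bounded.\<close>
lemma bernstein_sum_exp_abs_le:
  assumes "0 \<le> x" "x \<le> 1" "m > 0"
  shows "bernstein_sum m (\<lambda>k. exp \<bar>(real k - real m * x) / sqrt (real m)\<bar>) x \<le> 2 * exp 1"
proof -
  \<comment> \<open>Only the square of \<open>s\<close> is prescribed, so that both signs are
    covered at once.\<close>
  have one: "bernstein_sum m (\<lambda>k. exp (s * (real k - real m * x))) x \<le> exp 1"
    if s: "s\<^sup>2 = 1 / real m" for s
  proof -
    have "s\<^sup>2 \<le> 1" unfolding s using assms(3) by simp
    then have s1: "\<bar>s\<bar> \<le> 1" by (simp add: abs_square_le_1)
    have le1: "\<bar>s * y\<bar> \<le> 1" if "0 \<le> y" "y \<le> 1" for y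
      using mult_mono[of "\<bar>s\<bar>" 1 "\<bar>y\<bar>" 1] s1 that by (simp add: abs_mult)
    have "(1 - x) * exp (- s * x) + x * exp (s * (1 - x)) \<le>
        (1 - x) * (1 - s * x + (s * x)\<^sup>2) + x * (1 + s * (1 - x) + (s * (1 - x))\<^sup>2)"
      using exp_le_quadratic[of "- s * x"] exp_le_quadratic[of "s * (1 - x)"]
        le1[of x] le1[of "1 - x"] assms
      by (intro add_mono mult_left_mono) auto
    \<comment> \<open>The linear terms cancel because the variable is centred; the quadratic ones
      add up to its variance.\<close>
    also have "\<dots> = 1 + s\<^sup>2 * (x * (1 - x))"
      by (simp add: algebra_simps power2_eq_square)
    also have "\<dots> \<le> 1 + s\<^sup>2 * 1"
      using assms by (intro add_left_mono mult_left_mono mult_le_one) auto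
    also have "\<dots> \<le> exp (1 / real m)"
      using exp_ge_add_one_self[of "1 / real m"] s by simp
    finally have "((1 - x) * exp (- s * x) + x * exp (s * (1 - x))) ^ m \<le> exp (1 / real m) ^ m"
      using assms by (intro power_mono) auto
    also have "\<dots> = exp 1"
      using assms(3) by (simp add: exp_of_nat_mult[symmetric])
    finally show ?thesis by (simp add: bernstein_sum_exp)
  qed
  have abs: "exp \<bar>y\<bar> \<le> exp y + exp (- y)" for y :: real
    by (cases "0 \<le> y") auto
  define s where "s = 1 / sqrt (real m)"
  have s2: "s\<^sup>2 = 1 / real m" "(- s)\<^sup>2 = 1 / real m"
    using assms by (simp_all add: s_def power_divide)
  have "exp \<bar>(real k - real m * x) / sqrt (real m)\<bar> \<le>
      exp (s * (real k - real m * x)) + exp (- s * (real k - real m * x))" for k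
    using abs[of "(real k - real m * x) / sqrt (real m)"] by (simp add: s_def)
  then have "bernstein_sum m (\<lambda>k. exp \<bar>(real k - real m * x) / sqrt (real m)\<bar>) x \<le>
      bernstein_sum m (\<lambda>k. exp (s * (real k - real m * x))) x +
      bernstein_sum m (\<lambda>k. exp (- s * (real k - real m * x))) x"
    unfolding bernstein_sum_def sum.distrib[symmetric] distrib_right[symmetric]
    using assms by (intro sum_mono mult_right_mono Bernstein_nonneg)
  then show ?thesis using one[OF s2(1)] one[OF s2(2)] by simp
qed

text \<open>Raise \<open>y <= exp y\<close> at \<open>y = z / \<alpha>\<close> to the power
  \<alpha>. This trades polynomial growth for the exponential growth that the moment bound
  controls.\<close>

lemma powr_le_exp:
  fixes z \<alpha> :: real
  assumes "0 \<le> z" "0 < \<alpha>"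
  shows "z powr \<alpha> \<le> \<alpha> powr \<alpha> * exp z"
proof -
  have "z / \<alpha> \<le> exp (z / \<alpha>)"
    using exp_ge_add_one_self[of "z / \<alpha>"] by linarith
  then have "(z / \<alpha>) powr \<alpha> \<le> exp (z / \<alpha>) powr \<alpha>"
    using assms by (intro powr_mono2) auto
  also have "\<dots> = exp z" using assms by (simp add: powr_def)
  finally show ?thesis
    using assms by (simp add: powr_divide field_simps)
qed

section \<open>The cutoff function and the weighted norm\<close>

text \<open>Splitting off the triple zeros of \<open>\<psi>\<close> at 0 and of
  \<open>1 - \<psi>\<close> at 1 leaves quadratic factors that are positive where needed.\<close>

lemma psi_bounds: "0 \<le> \<psi> x" "\<psi> x \<le> 1"
proof -
  have 1: "10 * x ^ 3 - 15 * x ^ 4 + 6 * x ^ 5 = x ^ 3 * (6 * (x - 5/4)\<^sup>2 + 5/8)"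
    by (simp add: algebra_simps power2_eq_square eval_nat_numeral)
  have 2: "1 - (10 * x ^ 3 - 15 * x ^ 4 + 6 * x ^ 5) = (1 - x) ^ 3 * (6 * x\<^sup>2 + 3 * x + 1)"
    by (simp add: algebra_simps power2_eq_square eval_nat_numeral)
  have "0 \<le> 10 * x ^ 3 - 15 * x ^ 4 + 6 * x ^ 5" if "0 \<le> x"
    unfolding 1 using that by (intro mult_nonneg_nonneg) auto
  then show "0 \<le> \<psi> x" by (simp add: \<psi>_def)
  have "0 \<le> 1 - (10 * x ^ 3 - 15 * x ^ 4 + 6 * x ^ 5)" if "0 \<le> x" "x \<le> 1"
    unfolding 2 using that by (intro mult_nonneg_nonneg) auto
  then show "\<psi> x \<le> 1" by (simp add: \<psi>_def)
qed

text \<open>A real supremum dominates the values only if they are bounded above. The limit condition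
  at \<xi> makes the product continuous on a compact interval.\<close>

lemma wbar_mult_bounded:
  assumes "f \<in> C_wbar \<xi> \<alpha>"
  shows "bdd_above ((\<lambda>x. \<bar>wbar \<xi> \<alpha> x * f x\<bar>) ` {0..1})"
proof -
  have "continuous_on {0..1} (\<lambda>x. wbar \<xi> \<alpha> x * f x)"
    unfolding continuous_on_def
  proof
    fix x :: real assume x: "x \<in> {0..1}"
    show "((\<lambda>x. wbar \<xi> \<alpha> x * f x) \<longlongrightarrow> wbar \<xi> \<alpha> x * f x) (at x within {0..1})"
    proof (cases "x = \<xi>")
      case True
      \<comment> \<open>The value at \<xi> is 0 since \<open>0 powr \<alpha> = 0\<close>, and this
        is the prescribed limit.\<close>
      then show ?thesis using assms by (simp add: C_wbar_def wbar_def)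
    next
      case False
      have "(f \<longlongrightarrow> f x) (at x within ({0..1} - {\<xi>}))"
        using assms x False by (auto simp: C_wbar_def continuous_on_def)
      moreover have "at x within ({0..1} - {\<xi>}) = at x within {0..1}"
        using False by (intro at_within_nhd[of x "- {\<xi>}"]) auto
      ultimately have "(f \<longlongrightarrow> f x) (at x within {0..1})" by simp
      then show ?thesis
        unfolding wbar_def using False by (intro tendsto_intros) auto
    qed
  qed
  then have "compact ((\<lambda>x. \<bar>wbar \<xi> \<alpha> x * f x\<bar>) ` {0..1})"
    by (intro compact_continuous_image continuous_on_rabs) auto
  then show ?thesis by (intro bounded_imp_bdd_above compact_imp_bounded)
qed

text \<open>The scale \<open>r\<close> is kept apart from the distance of \<open>t\<close> to \<xi>,
  so that values of \<open>f\<close> at the nodes can be measured by a scale belonging to another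
  point.\<close>

lemma abs_le_of_wbar_mult_le:
  assumes "\<bar>wbar \<xi> \<alpha> t * f t\<bar> \<le> M" "0 \<le> M" "0 < \<alpha>" "0 < r" "r \<le> c * \<bar>t - \<xi>\<bar>" "0 < c"
  shows "\<bar>f t\<bar> \<le> M * (c / r) powr \<alpha>"
proof -
  have p: "0 < \<bar>t - \<xi>\<bar>" using assms(4-6) by (metis order_less_le_trans zero_less_mult_pos)
  have "\<bar>t - \<xi>\<bar> powr \<alpha> * \<bar>f t\<bar> \<le> M" using assms(1) by (simp add: wbar_def abs_mult)
  then have "\<bar>f t\<bar> \<le> M * (1 / \<bar>t - \<xi>\<bar>) powr \<alpha>"
    using p by (simp add: powr_divide field_simps)
  also have "\<dots> \<le> M * (c / r) powr \<alpha>"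
    using assms p by (intro mult_left_mono powr_mono2) (auto simp: field_simps)
  finally show ?thesis .
qed

section \<open>Nodes and truncated function for a fixed admissible \<open>n\<close>\<close>

context
  fixes \<xi> :: real and n :: nat
  assumes xi: "0 < \<xi>" "\<xi> < 1" and adm: "admissible \<xi> n"
begin

text \<open>Nonnegativity of \<open>x1\<close> gives \<open>2 * sqrt n <= n * \<xi> < n\<close>,
  hence \<open>sqrt n > 2\<close>.\<close>

lemma admissible_ge: "n \<ge> 5"
proof -
  have n: "0 < real n" using adm by (simp add: admissible_def)
  have "0 \<le> real n * \<xi> - 2 * sqrt (real n)"
    using adm n by (simp add: admissible_def x1_def zero_le_divide_iff)
  moreover have "real n * \<xi> < real n" using xi n by simp
  ultimately have "2 * sqrt (real n) < sqrt (real n) * sqrt (real n)" by simp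
  then have "2 < sqrt (real n)" using n by (simp only: mult_less_cancel_right) auto
  then have "sqrt 4 < sqrt (real n)" by simp
  then show ?thesis by (simp only: real_sqrt_less_iff)
qed

lemma inverse_le_inverse_sqrt: "2 * (1 / real n) \<le> 1 / sqrt (real n)"
proof -
  have "sqrt 4 \<le> sqrt (real n)" using admissible_ge by (simp only: real_sqrt_le_iff)
  then have "2 * sqrt (real n) \<le> sqrt (real n) * sqrt (real n)"
    by (intro mult_right_mono) auto
  then show ?thesis using admissible_ge by (simp add: field_simps)
qed

text \<open>Rounding down costs at most \<open>1 / n\<close>. The four nodes are the cases -2, -1, 1
  and 2 of \<open>c\<close>.\<close>

lemma floor_node_bounds:
  "\<xi> + c * (1 / sqrt (real n)) - 1 / real n \<le>
    real_of_int \<lfloor>real n * \<xi> + c * sqrt (real n)\<rfloor> / real n"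
  "real_of_int \<lfloor>real n * \<xi> + c * sqrt (real n)\<rfloor> / real n \<le> \<xi> + c * (1 / sqrt (real n))"
proof -
  define y where "y = real n * \<xi> + c * sqrt (real n)"
  have "y / real n = \<xi> + c * (sqrt (real n) / (sqrt (real n) * sqrt (real n)))"
    using admissible_ge by (simp add: y_def add_divide_distrib)
  also have "\<dots> = \<xi> + c * (1 / sqrt (real n))"
    using admissible_ge by (simp del: real_sqrt_mult_self)
  finally have y: "y / real n = \<xi> + c * (1 / sqrt (real n))" .
  have "(y - 1) / real n \<le> real_of_int \<lfloor>y\<rfloor> / real n" "real_of_int \<lfloor>y\<rfloor> / real n \<le> y / real n"
    by (intro divide_right_mono; linarith)+
  then show "\<xi> + c * (1 / sqrt (real n)) - 1 / real n \<le>
      real_of_int \<lfloor>real n * \<xi> + c * sqrt (real n)\<rfloor> / real n"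
    "real_of_int \<lfloor>real n * \<xi> + c * sqrt (real n)\<rfloor> / real n \<le> \<xi> + c * (1 / sqrt (real n))"
    unfolding diff_divide_distrib y unfolding y_def by auto
qed

text \<open>The rounding error is at most \<open>q / 2\<close>, so the nodes keep their order and
  their distances from \<xi> stay comparable to \<open>q\<close>.\<close>

lemma node_bounds:
  defines "q \<equiv> 1 / sqrt (real n)"
  shows "x1 \<xi> n \<le> \<xi> - 2 * q" "\<xi> - 3 * q \<le> x1 \<xi> n"
    and "x2 \<xi> n \<le> \<xi> - q" "x1 \<xi> n < x2 \<xi> n"
    and "\<xi> + q / 2 \<le> x3 \<xi> n" "x3 \<xi> n < x4 \<xi> n"
    and "\<xi> + q \<le> x4 \<xi> n" "x4 \<xi> n \<le> \<xi> + 2 * q"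
proof -
  define p where "p = 1 / real n"
  have p: "0 < p" "2 * p \<le> q"
    using admissible_ge inverse_le_inverse_sqrt by (simp_all add: p_def q_def)
  have x: "\<xi> - 2 * q - p \<le> x1 \<xi> n" "x1 \<xi> n \<le> \<xi> - 2 * q"
    "\<xi> - q - p \<le> x2 \<xi> n" "x2 \<xi> n \<le> \<xi> - q"
    "\<xi> + q - p \<le> x3 \<xi> n" "x3 \<xi> n \<le> \<xi> + q"
    "\<xi> + 2 * q - p \<le> x4 \<xi> n" "x4 \<xi> n \<le> \<xi> + 2 * q"
    unfolding x1_def x2_def x3_def x4_def
    using floor_node_bounds[of "-2", folded q_def p_def] floor_node_bounds[of "-1", folded q_def p_def]
      floor_node_bounds[of 1, folded q_def p_def] floor_node_bounds[of 2, folded q_def p_def]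
    by simp_all
  show "x1 \<xi> n \<le> \<xi> - 2 * q" "\<xi> - 3 * q \<le> x1 \<xi> n"
    "x2 \<xi> n \<le> \<xi> - q" "x1 \<xi> n < x2 \<xi> n"
    "\<xi> + q / 2 \<le> x3 \<xi> n" "x3 \<xi> n < x4 \<xi> n"
    "\<xi> + q \<le> x4 \<xi> n" "x4 \<xi> n \<le> \<xi> + 2 * q"
    using x p by linarith+
qed

lemma psi1_eq: "x2 \<xi> n \<le> t \<Longrightarrow> psi1 \<xi> n t = 1" "t \<le> x1 \<xi> n \<Longrightarrow> psi1 \<xi> n t = 0"
  using node_bounds(4) by (auto simp: psi1_def \<psi>_def divide_le_0_iff le_divide_eq_1)

lemma psi2_eq: "x4 \<xi> n \<le> t \<Longrightarrow> psi2 \<xi> n t = 1" "t \<le> x3 \<xi> n \<Longrightarrow> psi2 \<xi> n t = 0"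
  using node_bounds(6) by (auto simp: psi2_def \<psi>_def divide_le_0_iff le_divide_eq_1)

text \<open>Between the outer nodes, linear interpolation is a convex combination of the two end
  values.\<close>

lemma P_lin_abs_le:
  assumes "x1 \<xi> n \<le> t" "t \<le> x4 \<xi> n" "\<bar>f (x1 \<xi> n)\<bar> \<le> K" "\<bar>f (x4 \<xi> n)\<bar> \<le> K"
  shows "\<bar>P_lin \<xi> n f t\<bar> \<le> K"
proof -
  define a where "a = (t - x4 \<xi> n) / (x1 \<xi> n - x4 \<xi> n)"
  have "0 < 1 / sqrt (real n)" using admissible_ge by simp
  then have lt: "x1 \<xi> n < x4 \<xi> n" using node_bounds(1,7) by linarith
  then have a: "0 \<le> a" "0 \<le> 1 - a" "(x1 \<xi> n - t) / (x1 \<xi> n - x4 \<xi> n) = 1 - a"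
    using assms by (auto simp: a_def divide_simps)
  have "\<bar>P_lin \<xi> n f t\<bar> \<le> a * \<bar>f (x1 \<xi> n)\<bar> + (1 - a) * \<bar>f (x4 \<xi> n)\<bar>"
    unfolding P_lin_def a(3) a_def[symmetric]
    using a(1,2) by (intro order_trans[OF abs_triangle_ineq]) (auto simp: abs_mult)
  also have "\<dots> \<le> a * K + (1 - a) * K"
    using assms a by (intro add_mono mult_left_mono) auto
  finally show ?thesis by (simp add: algebra_simps)
qed

text \<open>The cutoffs suppress \<open>f t\<close> near \<xi> and \<open>P_lin\<close> away from
  it, so each term is estimated only where \<open>f\<close> is evaluated at distance at least
  \<open>r / 4\<close> from \<xi>.\<close>

lemma Fbar_abs_le:
  assumes \<alpha>: "0 < \<alpha>" and M: "\<And>t. t \<in> {0..1} \<Longrightarrow> \<bar>wbar \<xi> \<alpha> t * f t\<bar> \<le> M"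
    and t: "t \<in> {0..1}"
  shows "\<bar>Fbar \<xi> n f t\<bar> \<le> 3 * M * (4 / (\<bar>t - \<xi>\<bar> + 1 / sqrt (real n))) powr \<alpha>"
proof -
  define q where "q = 1 / sqrt (real n)"
  define r where "r = \<bar>t - \<xi>\<bar> + q"
  define K where "K = M * (4 / r) powr \<alpha>"
  have q: "0 < q" using admissible_ge by (simp add: q_def)
  then have r: "0 < r" by (simp add: r_def)
  have M0: "0 \<le> M" using M[OF t] by linarith
  then have K: "0 \<le> K" by (simp add: K_def)
  note nb = node_bounds[folded q_def]
  have f: "\<bar>f s\<bar> \<le> K" if "s \<in> {0..1}" "r \<le> 4 * \<bar>s - \<xi>\<bar>" for s
    unfolding K_def using abs_le_of_wbar_mult_le[of \<xi> \<alpha> s f M r 4] M[OF that(1)] M0 \<alpha> r that by simp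
  have \<psi>: "0 \<le> psi1 \<xi> n t" "psi1 \<xi> n t \<le> 1" "0 \<le> psi2 \<xi> n t" "psi2 \<xi> n t \<le> 1"
    by (simp_all add: psi1_def psi2_def psi_bounds)
  have A: "\<bar>f t * (1 - psi1 \<xi> n t + psi2 \<xi> n t)\<bar> \<le> K * 2"
  proof (cases "x2 \<xi> n \<le> t \<and> t \<le> x3 \<xi> n")
    case True
    \<comment> \<open>Here the factor of \<open>f t\<close> is exactly zero, so the singular value
      never enters.\<close>
    then show ?thesis using K by (simp add: psi1_eq psi2_eq)
  next
    case False
    \<comment> \<open>Outside the inner nodes the distance to \<xi> is at least
      \<open>q / 2\<close>.\<close>
    then have "r \<le> 4 * \<bar>t - \<xi>\<bar>"
      using nb(3,5) q unfolding r_def by auto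
    then show ?thesis
      unfolding abs_mult using f[OF t] K \<psi> by (intro mult_mono) auto
  qed
  have B: "\<bar>psi1 \<xi> n t * (1 - psi2 \<xi> n t) * P_lin \<xi> n f t\<bar> \<le> K"
  proof (cases "x1 \<xi> n \<le> t \<and> t \<le> x4 \<xi> n")
    case False
    then show ?thesis using K by (auto simp: psi1_eq psi2_eq)
  next
    case True
    \<comment> \<open>All of the interval lies within \<open>3 * q\<close> of \<xi>; this is the
      source of the constant 4. Both end nodes are at distance at least \<open>q\<close>, so
      \<open>f\<close> applies to them.\<close>
    have "r \<le> 4 * q" using True nb(2,8) q unfolding r_def by auto
    moreover have "q \<le> \<bar>x1 \<xi> n - \<xi>\<bar>" "q \<le> \<bar>x4 \<xi> n - \<xi>\<bar>"
      using nb(1,7) q by auto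
    moreover have "x1 \<xi> n \<in> {0..1}" "x4 \<xi> n \<in> {0..1}"
      using adm nb(1,7) xi q unfolding admissible_def by auto
    ultimately have "\<bar>P_lin \<xi> n f t\<bar> \<le> K"
      using True by (intro P_lin_abs_le f) auto
    moreover have "\<bar>psi1 \<xi> n t * (1 - psi2 \<xi> n t)\<bar> \<le> 1"
      using \<psi> by (simp add: abs_mult mult_le_one)
    ultimately show ?thesis
      unfolding abs_mult[of "psi1 \<xi> n t * (1 - psi2 \<xi> n t)"]
      using mult_mono[of _ 1 _ K] by fastforce
  qed
  have "\<bar>Fbar \<xi> n f t\<bar> \<le> K * 2 + K"
    unfolding Fbar_def using A B by linarith
  then show ?thesis by (simp add: K_def r_def q_def mult.assoc)
qed

section \<open>Weighted bounds for second differences and for the second derivative\<close>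

lemma wbar_second_difference_le:
  assumes \<alpha>: "0 < \<alpha>" and M: "\<And>t. t \<in> {0..1} \<Longrightarrow> \<bar>wbar \<xi> \<alpha> t * f t\<bar> \<le> M"
    and k: "k + 2 \<le> n" and x: "x \<in> {0..1}"
  defines "a \<equiv> \<lambda>k. Fbar \<xi> n f (real k / real n)"
  shows "wbar \<xi> \<alpha> x * \<bar>a (k + 2) - 2 * a (k + 1) + a k\<bar> \<le>
    12 * M * 12 powr \<alpha> * (\<alpha> powr \<alpha> * exp 3) *
      exp \<bar>(real k - real (n - 2) * x) / sqrt (real (n - 2))\<bar>"
proof -
  define q where "q = 1 / sqrt (real n)"
  define r where "r = \<bar>real k / real n - \<xi>\<bar> + q"
  define K where "K = 3 * M * (12 / r) powr \<alpha>"
  define u where "u = \<bar>(real k - real (n - 2) * x) / sqrt (real (n - 2))\<bar>"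
  have n: "0 < real n" "5 \<le> n" "0 < real (n - 2)" using admissible_ge by auto
  have q: "0 < q" using n by (simp add: q_def)
  then have r: "0 < r" by (simp add: r_def)
  have M0: "0 \<le> M" using M[OF x] by linarith
  have near: "\<bar>a (k + i)\<bar> \<le> K" if "i \<le> 2" for i
  proof -
    define t where "t = real (k + i) / real n"
    have t: "t \<in> {0..1}" using n k that by (auto simp: t_def)
    define h where "h = real i * (1 / real n)"
    have "t = real k / real n + h"
      by (simp add: t_def h_def add_divide_distrib)
    moreover have "h \<le> 2 * (1 / real n)"
      unfolding h_def using that by (intro mult_right_mono) auto
    then have "0 \<le> h" "h \<le> q"
      using inverse_le_inverse_sqrt unfolding q_def by (auto simp: h_def)
    ultimately have "\<bar>real k / real n - \<xi>\<bar> \<le> \<bar>t - \<xi>\<bar> + q"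
      using abs_triangle_ineq[of "t - \<xi>" "- h"] by simp
    moreover have "r = \<bar>real k / real n - \<xi>\<bar> + q" "0 \<le> \<bar>t - \<xi>\<bar>"
      by (simp_all add: r_def)
    \<comment> \<open>One \<open>q\<close> pays for moving from \<open>k / n\<close> to
      \<open>t\<close>, the other is already in \<open>r\<close>. The factor 3 turns the 4 of
      \<open>Fbar_abs_le\<close> into 12.\<close>
    ultimately have "r \<le> 3 * (\<bar>t - \<xi>\<bar> + q)"
      using q by argo
    then have "4 / (\<bar>t - \<xi>\<bar> + q) \<le> 12 / r"
      using r q by (simp add: field_simps)
    then have "3 * M * (4 / (\<bar>t - \<xi>\<bar> + q)) powr \<alpha> \<le> K"
      unfolding K_def using M0 \<alpha> q by (intro mult_left_mono powr_mono2) auto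
    then show ?thesis
      using Fbar_abs_le[OF \<alpha> M t] unfolding a_def t_def q_def by linarith
  qed
  have d: "\<bar>a (k + 2) - 2 * a (k + 1) + a k\<bar> \<le> 4 * K"
    using near[of 0] near[of 1] near[of 2] by simp
  have u: "\<bar>x - real k / real n\<bar> \<le> q * (2 + u)"
  proof -
    have "\<bar>x - real k / real n\<bar> = q * (\<bar>real n * x - real k\<bar> / sqrt (real n))"
    proof -
      have "x - real k / real n = (real n * x - real k) / real n"
        using n by (simp add: field_simps)
      also have "\<bar>\<dots>\<bar> = \<bar>real n * x - real k\<bar> / (sqrt (real n) * sqrt (real n))"
        by simp
      finally show ?thesis by (simp add: q_def)
    qed
    also have "\<dots> \<le> q * (2 + u)"
    proof (rule mult_left_mono)
      \<comment> \<open>Passing from degree \<open>n\<close> to \<open>n - 2\<close> shifts the mean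
        by \<open>2 * x\<close>, which is at most 2.\<close>
      have "\<bar>real n * x - real k\<bar> \<le> 2 + \<bar>real k - real (n - 2) * x\<bar>"
        using x n by (auto simp: of_nat_diff algebra_simps abs_if)
      then have "\<bar>real n * x - real k\<bar> / sqrt (real n) \<le>
          (2 + \<bar>real k - real (n - 2) * x\<bar>) / sqrt (real n)"
        by (intro divide_right_mono) auto
      also have "\<dots> \<le> 2 + \<bar>real k - real (n - 2) * x\<bar> / sqrt (real (n - 2))"
        unfolding add_divide_distrib
        using n by (intro add_mono divide_left_mono) (auto simp: divide_le_eq)
      finally show "\<bar>real n * x - real k\<bar> / sqrt (real n) \<le> 2 + u"
        by (simp add: u_def)
    qed (use q in simp)
    finally show ?thesis .
  qed
  have u0: "0 \<le> u" by (simp add: u_def)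
  have "\<bar>x - \<xi>\<bar> \<le> r + q * (2 + u)" using u q unfolding r_def by linarith
  \<comment> \<open>As \<open>q <= r\<close>, the scale \<open>r\<close> becomes a common factor and
    cancels against \<open>12 / r\<close>.\<close>
  also have "\<dots> \<le> r + r * (2 + u)"
    using u0 by (intro add_left_mono mult_right_mono) (auto simp: r_def)
  finally have le: "\<bar>x - \<xi>\<bar> * (12 / r) \<le> 12 * (3 + u)"
    using r by (simp add: field_simps)
  have "wbar \<xi> \<alpha> x * (12 / r) powr \<alpha> = (\<bar>x - \<xi>\<bar> * (12 / r)) powr \<alpha>"
    unfolding wbar_def using r by (subst powr_mult) auto
  also have "\<dots> \<le> (12 * (3 + u)) powr \<alpha>"
    using le \<alpha> r by (intro powr_mono2) auto
  also have "\<dots> = 12 powr \<alpha> * (3 + u) powr \<alpha>"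
    by (rule powr_mult)
  also have "\<dots> \<le> 12 powr \<alpha> * (\<alpha> powr \<alpha> * exp (3 + u))"
    using powr_le_exp[of "3 + u" \<alpha>] u0 \<alpha> by (intro mult_left_mono) auto
  finally have w: "wbar \<xi> \<alpha> x * (12 / r) powr \<alpha> \<le> 12 powr \<alpha> * (\<alpha> powr \<alpha> * exp (3 + u))" .
  have "wbar \<xi> \<alpha> x * \<bar>a (k + 2) - 2 * a (k + 1) + a k\<bar> \<le> wbar \<xi> \<alpha> x * (4 * K)"
    using d by (intro mult_left_mono) (auto simp: wbar_def)
  also have "\<dots> = 12 * M * (wbar \<xi> \<alpha> x * (12 / r) powr \<alpha>)"
    by (simp add: K_def)
  also have "\<dots> \<le> 12 * M * (12 powr \<alpha> * (\<alpha> powr \<alpha> * exp (3 + u)))"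
    using w M0 by (intro mult_left_mono) auto
  finally show ?thesis
    unfolding u_def[symmetric] exp_add by (simp add: mult.assoc)
qed

text \<open>The weight does not depend on \<open>k\<close> and moves inside the sum, where the
  termwise bound leaves an exponential moment of degree \<open>n - 2\<close>. The factor
  \<open>n * (n - 1)\<close> from differentiation yields the square of \<open>n\<close>.\<close>

lemma wbar_deriv2_Bbar_le:
  assumes \<alpha>: "0 < \<alpha>" and M: "\<And>t. t \<in> {0..1} \<Longrightarrow> \<bar>wbar \<xi> \<alpha> t * f t\<bar> \<le> M"
    and x: "x \<in> {0..1}"
  shows "\<bar>wbar \<xi> \<alpha> x * (deriv ^^ 2) (Bbar \<xi> n f) x\<bar> \<le>
    12 * 12 powr \<alpha> * (\<alpha> powr \<alpha> * exp 3) * (2 * exp 1) * (real n)\<^sup>2 * M"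
proof -
  define a where "a k = Fbar \<xi> n f (real k / real n)" for k
  define d where "d = (\<lambda>k. a (k + 2) - 2 * a (k + 1) + a k)"
  define D where "D = 12 * M * 12 powr \<alpha> * (\<alpha> powr \<alpha> * exp 3)"
  define e where "e k = exp \<bar>(real k - real (n - 2) * x) / sqrt (real (n - 2))\<bar>" for k
  have n: "n \<ge> 5" by (rule admissible_ge)
  have "0 \<le> M" using M[OF x] by linarith
  then have D: "0 \<le> D" by (simp add: D_def)
  have "\<bar>wbar \<xi> \<alpha> x * bernstein_sum (n - 2) d x\<bar> =
      \<bar>bernstein_sum (n - 2) (\<lambda>k. wbar \<xi> \<alpha> x * d k) x\<bar>"
    by (simp add: bernstein_sum_def sum_distrib_left mult.assoc)
  also have "\<dots> \<le> bernstein_sum (n - 2) (\<lambda>k. D * e k) x"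
  proof (rule bernstein_sum_abs_le)
    fix k assume "k \<le> n - 2"
    then show "\<bar>wbar \<xi> \<alpha> x * d k\<bar> \<le> D * e k"
      using wbar_second_difference_le[OF \<alpha> M _ x, of k] n
      unfolding d_def a_def D_def e_def by (simp add: abs_mult wbar_def)
  qed (use x in auto)
  also have "\<dots> = D * bernstein_sum (n - 2) e x"
    by (simp add: bernstein_sum_def sum_distrib_left mult.assoc)
  also have "\<dots> \<le> D * (2 * exp 1)"
    unfolding e_def using x n D by (intro mult_left_mono bernstein_sum_exp_abs_le) auto
  finally have *: "\<bar>wbar \<xi> \<alpha> x * bernstein_sum (n - 2) d x\<bar> \<le> D * (2 * exp 1)" .
  have "Bbar \<xi> n f = bernstein_sum n a"
    by (simp add: fun_eq_iff Bbar_def bernstein_op_def bernstein_sum_def a_def)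
  then have "\<bar>wbar \<xi> \<alpha> x * (deriv ^^ 2) (Bbar \<xi> n f) x\<bar> =
      real n * real (n - 1) * \<bar>wbar \<xi> \<alpha> x * bernstein_sum (n - 2) d x\<bar>"
    by (simp add: deriv2_bernstein_sum d_def abs_mult del: funpow.simps)
  also have "\<dots> \<le> (real n * real n) * (D * (2 * exp 1))"
    using * by (intro mult_mono) auto
  finally show ?thesis by (simp add: D_def power2_eq_square algebra_simps)
qed

end

theorem theorem1:
  fixes \<xi> \<alpha> :: real and f :: "real \<Rightarrow> real"
  assumes "0 < \<xi>" and "\<xi> < 1" and "0 < \<alpha>"
    and "f \<in> C_wbar \<xi> \<alpha>"
  shows "\<exists>C>0. \<forall>n. admissible \<xi> n \<longrightarrow>
    sup_norm (\<lambda>x. wbar \<xi> \<alpha> x * (deriv ^^ 2) (Bbar \<xi> n f) x)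
      \<le> C * (real n)\<^sup>2 * sup_norm (\<lambda>x. wbar \<xi> \<alpha> x * f x)"
proof -
  \<comment> \<open>This constant depends on \<alpha> alone; \<open>f\<close> enters only through
    its weighted norm.\<close>
  define C where "C = 12 * 12 powr \<alpha> * (\<alpha> powr \<alpha> * exp 3) * (2 * exp 1)"
  have "C > 0" using assms by (simp add: C_def)
  moreover have "sup_norm (\<lambda>x. wbar \<xi> \<alpha> x * (deriv ^^ 2) (Bbar \<xi> n f) x)
      \<le> C * (real n)\<^sup>2 * sup_norm (\<lambda>x. wbar \<xi> \<alpha> x * f x)" if "admissible \<xi> n" for n
    unfolding sup_norm_def[of "\<lambda>x. wbar \<xi> \<alpha> x * (deriv ^^ 2) (Bbar \<xi> n f) x"]
  proof (rule cSUP_least)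
    fix x :: real assume x: "x \<in> {0..1}"
    have "bdd_above ((\<lambda>x. \<bar>wbar \<xi> \<alpha> x * f x\<bar>) ` {0..1})"
      using assms(4) by (rule wbar_mult_bounded)
    then have M: "\<bar>wbar \<xi> \<alpha> t * f t\<bar> \<le> sup_norm (\<lambda>x. wbar \<xi> \<alpha> x * f x)" if "t \<in> {0..1}" for t
      unfolding sup_norm_def using that by (intro cSUP_upper)
    show "\<bar>wbar \<xi> \<alpha> x * (deriv ^^ 2) (Bbar \<xi> n f) x\<bar>
      \<le> C * (real n)\<^sup>2 * sup_norm (\<lambda>x. wbar \<xi> \<alpha> x * f x)"
      unfolding C_def
      by (rule wbar_deriv2_Bbar_le[OF assms(1,2) that assms(3) M x])
  qed simp
  ultimately show ?thesis by blast
qed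

end
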